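(* Let $\Gamma=(G,\sigma)$ be an unweighted signed graph with at least one edge, and let $\lambda_N(L^\sigma)$ be the largest eigenvalue of $L^{\sigma}$. Then $$\lambda_N(L^{\sigma})\leq \max_{u\sim v}\{d_u+d_v-\sharp^+(u,v)\}.$$
   Context: An unweighted signed graph $\Gamma=(G,\sigma)$ consists of a finite simple undirected graph $G=(V,E)$ with $N=|V|$ vertices and a signature $\sigma:E\to\{+1,-1\}$; write $\sigma(uv)=\sigma(\{u,v\})$ and $u\sim v$ if $\{u,v\}\in E$. $d_u$ is the degree (number of neighbors) of $u$, $D=\mathrm{diag}(d_u)$, $A^\sigma$ is the signed adjacency matrix ($A^\sigma_{uv}=\sigma(uv)$ for edges, $0$ otherwise), and $L^{\sigma}=D-A^{\sigma}$ with eigenvalues $\lambda_1(L^\sigma)\le\cdots\le\lambda_N(L^\sigma)$. For an edge $\{u,v\}$, $\sharp^{+}(u,v)$ is the number of vertices $u'$ with $u'\sim u$, $u'\sim v$ and $\sigma(uv)\sigma(vu')\sigma(u'u)=+1$. *)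

theory Defs
  imports "HOL-Analysis.Analysis"
begin

text \<open>
  The vertex set is the whole finite type \<^typ>\<open>'v\<close>; edges are two-element sets of vertices,
  so loops and multiple edges are excluded. The values of \<open>\<sigma>\<close> off \<open>E\<close> are irrelevant.
\<close>

definition signed_graph :: "'v::finite set set \<Rightarrow> ('v set \<Rightarrow> real) \<Rightarrow> bool" where
  "signed_graph E \<sigma> \<longleftrightarrow> (\<forall>e\<in>E. card e = 2) \<and> (\<forall>e\<in>E. \<sigma> e = 1 \<or> \<sigma> e = -1)"

definition vertex_degree :: "'v::finite set set \<Rightarrow> 'v \<Rightarrow> nat" where
  "vertex_degree E u = card {v. {u, v} \<in> E}"

definition degree_matrix :: "'v::finite set set \<Rightarrow> real^'v^'v" where
  "degree_matrix E = (\<chi> u v. if u = v then real (vertex_degree E u) else 0)"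

definition signed_adjacency :: "'v::finite set set \<Rightarrow> ('v set \<Rightarrow> real) \<Rightarrow> real^'v^'v" where
  "signed_adjacency E \<sigma> = (\<chi> u v. if {u, v} \<in> E then \<sigma> {u, v} else 0)"

definition signed_laplacian :: "'v::finite set set \<Rightarrow> ('v set \<Rightarrow> real) \<Rightarrow> real^'v^'v" where
  "signed_laplacian E \<sigma> = degree_matrix E - signed_adjacency E \<sigma>"

definition positive_triangles ::
    "'v::finite set set \<Rightarrow> ('v set \<Rightarrow> real) \<Rightarrow> 'v \<Rightarrow> 'v \<Rightarrow> nat" where
  "positive_triangles E \<sigma> u v =
     card {w. {w, u} \<in> E \<and> {w, v} \<in> E \<and> \<sigma> {u, v} * \<sigma> {v, w} * \<sigma> {w, u} = 1}"

definition eigenvalues :: "real^'n^'n \<Rightarrow> real set" where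
  "eigenvalues A = {k. \<exists>x. x \<noteq> 0 \<and> A *v x = k *\<^sub>R x}"

text \<open>
  Only meaningful if \<^term>\<open>eigenvalues A\<close> is finite and nonempty; for symmetric \<open>A\<close>, whose
  eigenvalues are all real, this is shown below.
\<close>

definition largest_eigenvalue :: "real^'n^'n \<Rightarrow> real" where
  "largest_eigenvalue A = Max (eigenvalues A)"

lemma transpose_signed_laplacian: "transpose (signed_laplacian E \<sigma>) = signed_laplacian E \<sigma>"
  by (simp add: signed_laplacian_def degree_matrix_def signed_adjacency_def transpose_def
      vec_eq_iff insert_commute)

lemma symmetric_matrix_inner:
  fixes A :: "real^'n^'n"
  assumes "transpose A = A"
  shows "x \<bullet> (A *v y) = (A *v x) \<bullet> y"
  by (metis assms dot_lmul_matrix transpose_matrix_vector)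

lemma finite_eigenvalues:
  fixes A :: "real^'n^'n"
  assumes sym: "transpose A = A"
  shows "finite (eigenvalues A)"
proof -
  have "\<forall>k\<in>eigenvalues A. \<exists>x. x \<noteq> 0 \<and> A *v x = k *\<^sub>R x"
    by (simp add: eigenvalues_def)
  then obtain f where f: "\<And>k. k \<in> eigenvalues A \<Longrightarrow> f k \<noteq> 0 \<and> A *v f k = k *\<^sub>R f k"
    by metis
  have inj: "inj_on f (eigenvalues A)"
    by (rule inj_onI) (metis f scaleR_cancel_right)
  have orth: "f k \<bullet> f l = 0" if "k \<in> eigenvalues A" "l \<in> eigenvalues A" "k \<noteq> l" for k l
  proof -
    have "l * (f k \<bullet> f l) = k * (f k \<bullet> f l)"
      using symmetric_matrix_inner[OF sym, of "f k" "f l"] f that by simp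
    then show ?thesis using that by simp
  qed
  have "independent (f ` eigenvalues A)"
  proof (rule pairwise_orthogonal_independent)
    show "pairwise orthogonal (f ` eigenvalues A)"
      unfolding pairwise_def orthogonal_def using orth by blast
    show "0 \<notin> f ` eigenvalues A" using f by force
  qed
  then have "finite (f ` eigenvalues A)"
    using independent_bound by blast
  then show ?thesis using inj finite_imageD by blast
qed

lemma eigenvalues_nonempty:
  fixes A :: "real^'n^'n"
  assumes sym: "transpose A = A"
  shows "eigenvalues A \<noteq> {}"
proof -
  have cont: "continuous_on (sphere 0 1) (\<lambda>x. x \<bullet> (A *v x))"
    by (intro continuous_intros linear_continuous_on matrix_vector_mul_bounded_linear)
  have "sphere 0 1 \<noteq> ({} :: (real^'n) set)"
    by simp
  then obtain x :: "real^'n" where x: "norm x = 1"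
      and max: "\<And>y. norm y = 1 \<Longrightarrow> y \<bullet> (A *v y) \<le> x \<bullet> (A *v x)"
    using continuous_attains_sup[OF compact_sphere _ cont] by auto
  define m where "m = x \<bullet> (A *v x)"
  define z where "z = A *v x - m *\<^sub>R x"
  have bound: "y \<bullet> (A *v y) \<le> m * (y \<bullet> y)" for y
  proof (cases "y = 0")
    case False
    let ?y = "(1 / norm y) *\<^sub>R y"
    have "?y \<bullet> (A *v ?y) \<le> m" unfolding m_def by (rule max) (simp add: False)
    then have "(y \<bullet> (A *v y)) / (norm y)\<^sup>2 \<le> m"
      by (simp add: matrix_vector_mult_scaleR power2_eq_square divide_simps)
    then show ?thesis
      using False by (simp add: divide_le_eq power2_norm_eq_inner)
  qed simp
  have xx: "x \<bullet> x = 1" using x by (simp add: norm_eq_1)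
  have zx: "z \<bullet> x = 0"
    by (simp add: z_def inner_diff_left m_def xx inner_commute[of "A *v x" x])
  have Ax: "A *v x = z + m *\<^sub>R x" by (simp add: z_def)
  define c where "c = m * (z \<bullet> z) - z \<bullet> (A *v z)"
  have quad: "2 * t * (z \<bullet> z) \<le> t\<^sup>2 * c" for t
  proof -
    let ?y = "x + t *\<^sub>R z"
    have "x \<bullet> (A *v z) = z \<bullet> z"
      by (simp add: symmetric_matrix_inner[OF sym] Ax inner_add_left zx inner_commute[of x z])
    then have "?y \<bullet> (A *v ?y) = m + 2 * t * (z \<bullet> z) + t\<^sup>2 * (z \<bullet> (A *v z))"
      by (simp add: matrix_vector_right_distrib matrix_vector_mult_scaleR Ax inner_add_left
          inner_add_right zx xx inner_commute[of x z] power2_eq_square algebra_simps)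
    moreover have "?y \<bullet> ?y = 1 + t\<^sup>2 * (z \<bullet> z)"
      by (simp add: inner_add_left inner_add_right zx xx inner_commute[of x z] power2_eq_square)
    ultimately show ?thesis
      using bound[of ?y] by (simp add: c_def algebra_simps)
  qed
  have c0: "c \<ge> 0" using bound[of z] by (simp add: c_def)
  have "z = 0"
  proof (rule ccontr)
    assume "z \<noteq> 0"
    then have pos: "z \<bullet> z > 0" by simp
    define t where "t = (z \<bullet> z) / (c + 1)"
    have t: "t > 0" using pos c0 by (simp add: t_def)
    have "2 * (z \<bullet> z) \<le> t * c"
      using quad[of t] t by (simp add: power2_eq_square mult.assoc mult.left_commute)
    also have "\<dots> \<le> t * (c + 1)" using t by simp
    also have "\<dots> = z \<bullet> z" using c0 by (simp add: t_def)
    finally show False using pos by simp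
  qed
  then have "A *v x = m *\<^sub>R x" "x \<noteq> 0" using Ax x by auto
  then show ?thesis unfolding eigenvalues_def by blast
qed

lemma largest_eigenvalue_signed_laplacian:
  "largest_eigenvalue (signed_laplacian E \<sigma>) \<in> eigenvalues (signed_laplacian E \<sigma>)"
  "k \<in> eigenvalues (signed_laplacian E \<sigma>) \<Longrightarrow> k \<le> largest_eigenvalue (signed_laplacian E \<sigma>)"
  unfolding largest_eigenvalue_def
  using finite_eigenvalues eigenvalues_nonempty transpose_signed_laplacian Max_in Max_ge by blast+

end

theory Submission
  imports Defs
begin

text \<open>
  For an eigenvector \<open>x\<close> put \<open>y(u,v) = x\<^sub>u - \<sigma>(uv) x\<^sub>v\<close> on directed edges. The eigenvalue equation
  gives \<open>\<lambda> y(u,v)\<close> as the sum of \<open>y(u,w)\<close> over the neighbours \<open>w\<close> of \<open>u\<close> minus \<open>\<sigma>(uv)\<close> times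
  the sum of \<open>y(v,w)\<close> over the neighbours of \<open>v\<close>. A positive triangle \<open>uvw\<close> satisfies
  \<open>y(u,w) - \<sigma>(uv) y(v,w) = y(u,v)\<close>, so its two terms together count only once. Taking the edge
  that maximizes \<open>\<bar>y\<bar>\<close> bounds \<open>\<lambda>\<close> unless \<open>y = 0\<close>, and then \<open>\<lambda> = 0\<close>.
\<close>

text \<open>This is the signed coboundary of \<open>x\<close>. On an edge with sign 1 or -1,
  swapping \<open>u\<close> and \<open>v\<close> changes it at most by a sign, so its absolute value
  does not depend on the orientation.\<close>

definition edge_difference :: "('v set \<Rightarrow> real) \<Rightarrow> real^'v \<Rightarrow> 'v \<Rightarrow> 'v \<Rightarrow> real" where
  "edge_difference \<sigma> x u v = x $ u - \<sigma> {u, v} * x $ v"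

lemma signed_laplacian_mult_component:
  fixes E :: "'v::finite set set"
  shows "(signed_laplacian E \<sigma> *v x) $ u = (\<Sum>w\<in>{w. {u, w} \<in> E}. edge_difference \<sigma> x u w)"
proof -
  have "(signed_laplacian E \<sigma> *v x) $ u =
      (\<Sum>w\<in>UNIV. (if u = w then real (vertex_degree E u) * x $ w else 0)
        - (if {u, w} \<in> E then \<sigma> {u, w} * x $ w else 0))"
    unfolding signed_laplacian_def degree_matrix_def signed_adjacency_def matrix_vector_mult_def
    by (auto simp: left_diff_distrib intro!: sum.cong)
  also have "\<dots> = real (vertex_degree E u) * x $ u
      - (\<Sum>w\<in>{w. {u, w} \<in> E}. \<sigma> {u, w} * x $ w)"
    by (simp add: sum_subtractf sum.If_cases)
  finally show ?thesis
    by (simp add: edge_difference_def sum_subtractf vertex_degree_def)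
qed

text \<open>Makes the bound nonnegative, which settles the case of eigenvalue 0.\<close>

lemma positive_triangles_le_vertex_degree:
  fixes E :: "'v::finite set set"
  shows "positive_triangles E \<sigma> u v \<le> vertex_degree E u"
  unfolding positive_triangles_def vertex_degree_def
  by (intro card_mono) (auto simp: insert_commute)

text \<open>Since signs are their own inverses, positivity of the triangle says that
  \<open>\<sigma> {u, w} = \<sigma> {u, v} * \<sigma> {v, w}\<close>, so the two terms in
  \<open>x $ w\<close> cancel.\<close>

lemma edge_difference_positive_triangle:
  assumes "signed_graph E \<sigma>" and "{u, v} \<in> E" "{w, u} \<in> E" "{w, v} \<in> E"
    and "\<sigma> {u, v} * \<sigma> {v, w} * \<sigma> {w, u} = 1"
  shows "edge_difference \<sigma> x u w - \<sigma> {u, v} * edge_difference \<sigma> x v w = edge_difference \<sigma> x u v"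
proof -
  have "\<sigma> {w, u} = 1 \<or> \<sigma> {w, u} = -1"
    using assms by (auto simp: signed_graph_def)
  then have "\<sigma> {u, w} = \<sigma> {u, v} * \<sigma> {v, w}"
    using assms(5) by (auto simp: insert_commute)
  then show ?thesis
    by (simp add: edge_difference_def algebra_simps)
qed

lemma eigenvalue_le_at_maximal_edge:
  fixes E :: "'v::finite set set"
  assumes graph: "signed_graph E \<sigma>" and eig: "signed_laplacian E \<sigma> *v x = k *\<^sub>R x"
    and uv: "{u, v} \<in> E" and pos: "edge_difference \<sigma> x u v \<noteq> 0"
    and max: "\<And>a b. {a, b} \<in> E \<Longrightarrow> \<bar>edge_difference \<sigma> x a b\<bar> \<le> \<bar>edge_difference \<sigma> x u v\<bar>"
  shows "k \<le> real (vertex_degree E u) + real (vertex_degree E v)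
    - real (positive_triangles E \<sigma> u v)"
proof -
  let ?y = "edge_difference \<sigma> x" and ?s = "\<sigma> {u, v}"
  define M where "M = \<bar>?y u v\<bar>"
  define Nu where "Nu = {w. {u, w} \<in> E}"
  define Nv where "Nv = {w. {v, w} \<in> E}"
  define P where "P = {w. {w, u} \<in> E \<and> {w, v} \<in> E \<and> ?s * \<sigma> {v, w} * \<sigma> {w, u} = 1}"
  have sub: "P \<subseteq> Nu" "P \<subseteq> Nv"
    by (auto simp: P_def Nu_def Nv_def insert_commute)
  have "\<bar>?s\<bar> = 1"
    using graph uv by (auto simp: signed_graph_def)
  have component: "k * x $ a = (\<Sum>w\<in>{w. {a, w} \<in> E}. ?y a w)" for a
    using signed_laplacian_mult_component[of E \<sigma> x a] eig by simp
  have "k * ?y u v = k * x $ u - ?s * (k * x $ v)"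
    by (simp add: edge_difference_def algebra_simps)
  also have "\<dots> = (\<Sum>w\<in>Nu. ?y u w) - (\<Sum>w\<in>Nv. ?s * ?y v w)"
    by (simp only: component Nu_def Nv_def sum_distrib_left)
  \<comment> \<open>\<open>P\<close> lies in both neighbourhoods, so its terms can be taken out of
    both sums and paired.\<close>
  also have "\<dots> = (\<Sum>w\<in>Nu - P. ?y u w) - (\<Sum>w\<in>Nv - P. ?s * ?y v w)
      + (\<Sum>w\<in>P. ?y u w - ?s * ?y v w)"
    using sum.subset_diff[OF sub(1), of "?y u"] sum.subset_diff[OF sub(2), of "\<lambda>w. ?s * ?y v w"]
    by (simp add: sum_subtractf)
  also have "(\<Sum>w\<in>P. ?y u w - ?s * ?y v w) = (\<Sum>w\<in>P. ?y u v)"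
    by (intro sum.cong refl edge_difference_positive_triangle[OF graph uv]) (auto simp: P_def)
  finally have "\<bar>k * ?y u v\<bar> \<le> \<bar>\<Sum>w\<in>Nu - P. ?y u w\<bar> + \<bar>\<Sum>w\<in>Nv - P. ?s * ?y v w\<bar>
      + \<bar>\<Sum>w\<in>P. ?y u v\<bar>"
    by linarith
  \<comment> \<open>Every summand is at most \<open>M\<close> in absolute value by maximality, as
    \<open>?s\<close> has absolute value 1.\<close>
  also have "\<dots> \<le> (\<Sum>w\<in>Nu - P. M) + (\<Sum>w\<in>Nv - P. M) + (\<Sum>w\<in>P. M)"
    using max \<open>\<bar>?s\<bar> = 1\<close>
    by (intro add_mono order_trans[OF sum_abs] sum_mono)
      (auto simp: M_def Nu_def Nv_def abs_mult)
  also have "\<dots> = (real (card Nu) + real (card Nv) - real (card P)) * M"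
    using card_mono[OF _ sub(1)] card_mono[OF _ sub(2)]
    by (simp add: card_Diff_subset sub algebra_simps)
  finally have "\<bar>k\<bar> * M \<le> (real (card Nu) + real (card Nv) - real (card P)) * M"
    by (simp add: abs_mult M_def)
  \<comment> \<open>Cancelling \<open>M\<close> bounds even \<open>\<bar>k\<bar>\<close>.\<close>
  moreover have "M > 0"
    using pos by (simp add: M_def)
  ultimately show ?thesis
    by (simp add: Nu_def Nv_def P_def vertex_degree_def positive_triangles_def)
qed

lemma eigenvalue_signed_laplacian_le:
  fixes E :: "'v::finite set set"
  assumes graph: "signed_graph E \<sigma>" and "E \<noteq> {}"
    and "k \<in> eigenvalues (signed_laplacian E \<sigma>)"
  obtains u v where "{u, v} \<in> E"
    and "k \<le> real (vertex_degree E u) + real (vertex_degree E v)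
      - real (positive_triangles E \<sigma> u v)"
proof -
  obtain x where "x \<noteq> 0" and eig: "signed_laplacian E \<sigma> *v x = k *\<^sub>R x"
    using assms(3) by (auto simp: eigenvalues_def)
  let ?S = "{(a, b). {a, b} \<in> E}" and ?f = "\<lambda>(a, b). \<bar>edge_difference \<sigma> x a b\<bar>"
  have "?S \<noteq> {}"
    using assms(1,2) by (fastforce simp: signed_graph_def card_2_iff)
  then have "Max (?f ` ?S) \<in> ?f ` ?S"
    by (intro Max_in) auto
  then obtain p where "p \<in> ?S" "Max (?f ` ?S) = ?f p"
    by blast
  moreover from this have "?f q \<le> ?f p" if "q \<in> ?S" for q
    using Max_ge[of "?f ` ?S" "?f q"] that by simp
  ultimately obtain u v where uv: "{u, v} \<in> E"
    and max: "\<And>a b. {a, b} \<in> E \<Longrightarrow> \<bar>edge_difference \<sigma> x a b\<bar> \<le> \<bar>edge_difference \<sigma> x u v\<bar>"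
    by (cases p) auto
  show thesis
  proof (cases "edge_difference \<sigma> x u v = 0")
    case False
    then show thesis
      using that[OF uv] eigenvalue_le_at_maximal_edge[OF graph eig uv _ max] by blast
  next
    case True
    \<comment> \<open>As the maximum is 0, the differences vanish on all edges, and each component
      of the Laplacian applied to \<open>x\<close> is a sum of them.\<close>
    then have "k *\<^sub>R x = 0"
      using max by (auto simp flip: eig simp: vec_eq_iff signed_laplacian_mult_component
          intro!: sum.neutral)
    then have "k = 0"
      using \<open>x \<noteq> 0\<close> by simp
    then show thesis
      using that[OF uv] positive_triangles_le_vertex_degree[of E \<sigma> u v] by simp
  qed
qed

theorem theorem1p8:
  fixes E :: "'v::finite set set" and \<sigma> :: "'v set \<Rightarrow> real"
  assumes "signed_graph E \<sigma>"
    and "E \<noteq> {}"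
  shows "largest_eigenvalue (signed_laplacian E \<sigma>)
    \<le> Max {real (vertex_degree E u) + real (vertex_degree E v) - real (positive_triangles E \<sigma> u v) | u v. {u, v} \<in> E}"
    (is "_ \<le> Max ?B")
proof -
  let ?g = "\<lambda>(u, v). real (vertex_degree E u) + real (vertex_degree E v)
    - real (positive_triangles E \<sigma> u v)"
  \<comment> \<open>\<open>Max\<close> bounds the elements of a finite set only; \<open>?g\<close>
    has a finite domain.\<close>
  have "?B \<subseteq> range ?g"
    by auto
  then have "finite ?B"
    by (rule finite_subset) simp
  obtain u v where "{u, v} \<in> E" "largest_eigenvalue (signed_laplacian E \<sigma>) \<le> ?g (u, v)"
    using eigenvalue_signed_laplacian_le[OF assms largest_eigenvalue_signed_laplacian(1)] by auto
  moreover from this have "?g (u, v) \<le> Max ?B"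
    by (intro Max_ge[OF \<open>finite ?B\<close>]) auto
  ultimately show ?thesis
    by linarith
qed

end
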